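(* Let $R$ be a commutative ring and let $n \geq 2$ be an integer. Then the following are equivalent: (1) $R$ is an $n$-SRC ring. (2) $R$ is a local $n$-SRC ring. (3) $R$ is local and the matrix ring ${\mathbb M}_{n}(R)$ is strongly clean.
   Context: All rings are associative with identity; $U(R)$ is the group of units of $R$. An element $a$ of a ring $S$ is strongly clean if $a=e+u$ with $e^2=e\in S$, $u\in U(S)$ and $eu=ue$; $S$ is a strongly clean ring if every element of $S$ is strongly clean. Let $R$ be a commutative ring and $f(t)\in R[t]$ monic. An SR factorization of $f$ is a factorization $f(t)=f_0(t)f_1(t)$ in $R[t]$ with $f_0,f_1$ monic such that there are idempotents $e_0\neq e_1$ in $R$ with $f_0(e_0)\in U(R)$ and $f_1(e_1)\in U(R)$. It is an SRC factorization if, in addition, $(f_0,f_1)$ is unimodular, i.e. $f_0(t)R[t]+f_1(t)R[t]=R[t]$. (The factors are allowed to be equal to $1$.) $R$ is an $n$-SRC ring if every monic polynomial of degree $n$ in $R[t]$ has an SRC factorization. *)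

theory Defs
  imports "HOL-Algebra.Algebraic_Closure_Type" "Jordan_Normal_Form.Char_Poly"
begin

definition strongly_clean :: "('a, 'm) ring_scheme \<Rightarrow> 'a \<Rightarrow> bool" where
  "strongly_clean S a \<longleftrightarrow>
    (\<exists>e\<in>carrier S. \<exists>u\<in>Units S.
      e \<otimes>\<^bsub>S\<^esub> e = e \<and> e \<otimes>\<^bsub>S\<^esub> u = u \<otimes>\<^bsub>S\<^esub> e \<and> a = e \<oplus>\<^bsub>S\<^esub> u)"

definition strongly_clean_ring :: "('a, 'm) ring_scheme \<Rightarrow> bool" where
  "strongly_clean_ring S \<longleftrightarrow> ring S \<and> (\<forall>a\<in>carrier S. strongly_clean S a)"

definition local_ring :: "('a, 'm) ring_scheme \<Rightarrow> bool" where
  "local_ring R \<longleftrightarrow> cring R \<and> (\<exists>!M. maximalideal M R)"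

text \<open>A polynomial is monic when its \<^const>\<open>lead_coeff\<close> is 1; the constant polynomial 1 is
  monic, so trivial factors are allowed below. Membership in U(R) is divisibility of 1.\<close>

definition SR_factorization ::
    "'a::comm_ring_1 poly \<Rightarrow> 'a poly \<Rightarrow> 'a poly \<Rightarrow> bool" where
  "SR_factorization f f0 f1 \<longleftrightarrow>
    f = f0 * f1 \<and> lead_coeff f0 = 1 \<and> lead_coeff f1 = 1 \<and>
    (\<exists>e0 e1. e0 * e0 = e0 \<and> e1 * e1 = e1 \<and> e0 \<noteq> e1 \<and>
      poly f0 e0 dvd 1 \<and> poly f1 e1 dvd 1)"

definition unimodular :: "'a::comm_ring_1 poly \<Rightarrow> 'a poly \<Rightarrow> bool" where
  "unimodular f0 f1 \<longleftrightarrow> {f0 * p + f1 * q | p q. True} = UNIV"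

definition SRC_factorization ::
    "'a::comm_ring_1 poly \<Rightarrow> 'a poly \<Rightarrow> 'a poly \<Rightarrow> bool" where
  "SRC_factorization f f0 f1 \<longleftrightarrow> SR_factorization f f0 f1 \<and> unimodular f0 f1"

definition SRC_ring :: "'a::comm_ring_1 itself \<Rightarrow> nat \<Rightarrow> bool" where
  "SRC_ring R n \<longleftrightarrow>
    (\<forall>f :: 'a poly. lead_coeff f = 1 \<and> degree f = n \<longrightarrow>
      (\<exists>f0 f1. SRC_factorization f f0 f1))"

end

theory Submission
  imports Defs
begin

text \<open>Both equivalences rest on arithmetic in \<open>R[t]\<close>.

  \<^bold>\<open>An n-SRC ring is local.\<close> If \<open>M\<close> and \<open>N\<close> are distinct maximal ideals, choose \<open>a \<in> M\<close> with
  \<open>1 - a \<in> N\<close> and consider \<open>f = t\<^sup>n\<^sup>-\<^sup>1 (t - a)\<close>. Modulo \<open>M\<close> it is \<open>t\<^sup>n\<close>, a power of a prime, so in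
  a unimodular factorization into monic polynomials one factor is \<open>1\<close> and the other is \<open>f\<close>.
  As \<open>n \<ge> 2\<close>, however, \<open>f(e) = e (1 - a) \<in> N\<close> for every idempotent \<open>e\<close>, so no such value is
  a unit.

  \<^bold>\<open>Matrices and factorizations over a local ring.\<close> The link is the condition
  \<open>strongly_clean_root f\<close>: the class of \<open>t\<close> is strongly clean in \<open>R[t]/(f)\<close>. If \<open>f\<close> is the characteristic
  polynomial of \<open>A\<close>, Cayley-Hamilton gives a ring homomorphism \<open>R[t]/(f) \<rightarrow> R[A]\<close> with \<open>t \<mapsto> A\<close>,
  and the decomposition of \<open>t\<close> becomes one of \<open>A\<close>. Conversely, the companion matrix of \<open>f\<close> is
  multiplication by \<open>t\<close> on \<open>R[t]/(f)\<close>, and whatever commutes with it is multiplication by an element;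
  so a decomposition of that matrix comes from one of \<open>t\<close>.

  Finally, over a local ring \<open>t\<close> is strongly clean modulo a monic \<open>f\<close> iff \<open>f\<close> has an SRC factorization. The only
  idempotents are \<open>0\<close> and \<open>1\<close>, so up to exchanging the factors \<open>f\<^sub>0(1)\<close> and \<open>f\<^sub>1(0)\<close> are units.
  From \<open>f\<^sub>0 p + f\<^sub>1 q = 1\<close> the idempotent is \<open>g = f\<^sub>1 q\<close>; then \<open>t - g\<close> is \<open>t\<close> modulo \<open>f\<^sub>1\<close> and \<open>t - 1\<close>
  modulo \<open>f\<^sub>0\<close>, and these are units there iff \<open>f\<^sub>1(0)\<close> and \<open>f\<^sub>0(1)\<close> are units of \<open>R\<close>. The deep direction
  is to recover the factors from the idempotent \<open>g\<close>: modulo the maximal ideal they are the monic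
  generators of the annihilators of \<open>g\<close> and \<open>1 - g\<close>, and a Nakayama argument lifts them to \<open>R[t]\<close>
  (lemma \<open>idempotent_factorization\<close>).\<close>

section \<open>Monic polynomials over a commutative ring\<close>

lemma degree_lead_coeff_eqI:
  fixes p :: "'a::zero_neq_one poly"
  assumes "coeff p k = 1" "\<And>i. i > k \<Longrightarrow> coeff p i = 0"
  shows "degree p = k \<and> lead_coeff p = 1"
proof -
  have "degree p \<le> k" using assms(2) by (intro degree_le) auto
  moreover have "k \<le> degree p" using assms(1) by (intro le_degree) auto
  ultimately show ?thesis using assms(1) by auto
qed

lemma monic_mult_cancel:
  fixes p q :: "'a::comm_ring_1 poly"
  assumes "lead_coeff p = 1" "p * q = 0"
  shows "q = 0"
  using lcoeff_monic_mult[OF assms(1), of q] assms(2) by auto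

lemma monic_mult_dvd_cancel:
  fixes p q r :: "'a::comm_ring_1 poly"
  assumes "lead_coeff p = 1" "p * q dvd p * r"
  shows "q dvd r"
proof -
  from assms(2) obtain c where "p * r = p * q * c" by (rule dvdE)
  then have "p * (r - q * c) = 0" by (simp add: algebra_simps)
  then have "r - q * c = 0" by (rule monic_mult_cancel[OF assms(1)])
  then show ?thesis by (metis dvd_triv_left eq_iff_diff_eq_0)
qed

lemma degree_mult_monic:
  fixes p q :: "'a::comm_ring_1 poly"
  assumes "lead_coeff p = 1" "lead_coeff q = 1"
  shows "degree (p * q) = degree p + degree q" "lead_coeff (p * q) = 1"
proof -
  have "q \<noteq> 0" using assms(2) by auto
  then show "degree (p * q) = degree p + degree q"
    using degree_monic_mult[OF assms(1)] by blast
  then show "lead_coeff (p * q) = 1"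
    using lcoeff_monic_mult[OF assms(1), of q] assms(2) by simp
qed

lemma monic_dvd_monic_same_degree:
  fixes p q :: "'a::comm_ring_1 poly"
  assumes "lead_coeff p = 1" "lead_coeff q = 1" "degree p = degree q" "p dvd q"
  shows "p = q"
proof -
  from assms(4) obtain c where c: "q = p * c" by (rule dvdE)
  have "c \<noteq> 0" using c assms(2) by auto
  then have "degree q = degree p + degree c" using degree_monic_mult[OF assms(1)] c by blast
  then have "degree c = 0" using assms(3) by simp
  moreover have "lead_coeff c = 1"
    using lcoeff_monic_mult[OF assms(1), of c] c assms(2) \<open>degree q = degree p + degree c\<close> by simp
  ultimately have "c = 1" by (elim degree_eq_zeroE) (simp add: one_pCons)
  then show ?thesis using c by simp
qed

section \<open>Ideals and polynomials modulo an ideal\<close>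

locale comm_ideal =
  fixes I :: "'a::comm_ring_1 set"
  assumes zero_mem: "0 \<in> I"
    and add_mem: "x \<in> I \<Longrightarrow> y \<in> I \<Longrightarrow> x + y \<in> I"
    and mult_mem: "x \<in> I \<Longrightarrow> r * x \<in> I"
begin

lemma diff_mem: "x \<in> I \<Longrightarrow> y \<in> I \<Longrightarrow> x - y \<in> I"
  using add_mem[of x "- y"] mult_mem[of y "- 1"] by simp

lemma sum_mem: "(\<And>i. i \<in> A \<Longrightarrow> g i \<in> I) \<Longrightarrow> sum g A \<in> I"
  by (induction A rule: infinite_finite_induct) (auto intro: zero_mem add_mem)

definition coeffs_in :: "'a poly \<Rightarrow> bool" where
  "coeffs_in p \<longleftrightarrow> (\<forall>i. coeff p i \<in> I)"

lemma coeffs_in_diff: "coeffs_in p \<Longrightarrow> coeffs_in q \<Longrightarrow> coeffs_in (p - q)"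
  and coeffs_in_0: "coeffs_in 0"
  by (auto simp: coeffs_in_def intro: diff_mem zero_mem)

lemma coeffs_in_mult: "coeffs_in p \<Longrightarrow> coeffs_in (q * p)"
  unfolding coeffs_in_def coeff_mult by (auto intro: sum_mem mult_mem)

text \<open>Division by a monic polynomial needs no inverses. The last conjunct says that the procedure may
  be carried out inside \<open>I[t]\<close>. The degree bound is put coefficientwise so that it also covers
  \<open>degree h = 0\<close>, where the remainder vanishes.\<close>
lemma monic_division:
  fixes h p :: "'a poly"
  assumes h: "lead_coeff h = 1"
  shows "\<exists>q r. p = h * q + r \<and> (\<forall>i\<ge>degree h. coeff r i = 0) \<and> (coeffs_in p \<longrightarrow> coeffs_in r)"
proof (induction p)
  case 0
  show ?case by (intro exI[of _ 0]) auto
next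
  case (pCons a p)
  then obtain q r where p: "p = h * q + r" and r: "\<forall>i\<ge>degree h. coeff r i = 0"
    and I: "coeffs_in p \<longrightarrow> coeffs_in r" by blast
  define c where "c = coeff (pCons a r) (degree h)"
  define r' where "r' = pCons a r - smult c h"
  have "pCons a p = h * (pCons 0 q + [:c:]) + r'"
    unfolding p r'_def by (simp add: algebra_simps)
  moreover have "\<forall>i\<ge>degree h. coeff r' i = 0"
  proof (intro allI impI)
    fix i assume i: "i \<ge> degree h"
    show "coeff r' i = 0"
    proof (cases "i = degree h")
      case True
      then show ?thesis using h by (simp add: r'_def c_def)
    next
      case False
      with i have "i > degree h" by simp
      then show ?thesis using r by (cases i) (auto simp: r'_def coeff_eq_0)
    qed
  qed
  moreover have "coeffs_in r'" if ap: "coeffs_in (pCons a p)"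
  proof -
    have a: "a \<in> I" using ap unfolding coeffs_in_def by (metis coeff_pCons_0)
    have "coeffs_in p" using ap unfolding coeffs_in_def by (metis coeff_pCons_Suc)
    with I have "coeffs_in r" by blast
    with a have ar: "coeffs_in (pCons a r)"
      by (auto simp: coeffs_in_def coeff_pCons split: nat.split)
    then have "c \<in> I" by (auto simp: coeffs_in_def c_def)
    then have "coeffs_in (smult c h)"
      by (auto simp: coeffs_in_def intro: mult_mem simp: mult.commute[of c])
    with ar show ?thesis unfolding r'_def by (rule coeffs_in_diff)
  qed
  ultimately show ?case by blast
qed

text \<open>Membership in \<open>(f) + I[t]\<close>. When \<open>I\<close> is a maximal ideal this is divisibility by the reduction of \<open>f\<close>
  over the residue field, expressed without passing to the quotient ring.\<close>
definition in_sum :: "'a poly \<Rightarrow> 'a poly \<Rightarrow> bool" where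
  "in_sum f p \<longleftrightarrow> (\<exists>m. coeffs_in m \<and> f dvd p - m)"

lemma in_sum_dvd: "f dvd p \<Longrightarrow> in_sum f p"
  unfolding in_sum_def by (rule exI[of _ 0]) (simp add: coeffs_in_0)

lemma in_sum_coeffs: "coeffs_in p \<Longrightarrow> in_sum f p"
  unfolding in_sum_def by (rule exI[of _ p]) simp

lemma in_sum_diff:
  assumes "in_sum f p" "in_sum f q"
  shows "in_sum f (p - q)"
proof -
  obtain m k where *: "coeffs_in m" "coeffs_in k" "f dvd p - m" "f dvd q - k"
    using assms unfolding in_sum_def by blast
  have "f dvd (p - m) - (q - k)" by (rule dvd_diff[OF *(3,4)])
  then have "f dvd (p - q) - (m - k)" by (simp add: algebra_simps)
  then show ?thesis unfolding in_sum_def using coeffs_in_diff[OF *(1,2)] by blast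
qed

lemma in_sum_mult:
  assumes "in_sum f p" shows "in_sum f (c * p)"
proof -
  obtain m where *: "coeffs_in m" "f dvd p - m"
    using assms unfolding in_sum_def by blast
  have "f dvd c * (p - m)" using * by (intro dvd_mult)
  then have "f dvd c * p - c * m" by (simp add: algebra_simps)
  then show ?thesis unfolding in_sum_def using coeffs_in_mult[OF *(1)] by blast
qed

end

section \<open>Idempotents modulo a polynomial over a local ring\<close>

locale local_ideal = comm_ideal +
  assumes one_notin: "1 \<notin> I"
    and unit: "x \<notin> I \<Longrightarrow> x dvd 1"
begin

text \<open>Lifts a monic annihilator of \<open>g\<close> from the residue field to the local ring. In module terms:
  the ideal generated by \<open>g\<close> in \<open>R[t]/(f)\<close> is generated over \<open>R\<close> by the elements \<open>t\<^sup>i g\<close>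
  with \<open>i < degree f\<close>; the relation \<open>h g \<equiv> 0\<close> over the residue field lets Nakayama's lemma discard
  all those with \<open>i \<ge> degree h\<close>, and expressing \<open>t\<^sup>d g\<close>, \<open>d = degree h\<close>, in the remaining ones gives \<open>h'\<close>.
  The proof discards one generator at a time, starting from the annihilator \<open>f\<close>.\<close>
lemma nakayama_annihilator:
  fixes f g h :: "'a poly"
  assumes f: "lead_coeff f = 1" and idem: "f dvd g * g - g"
    and h: "lead_coeff h = 1" "degree h \<le> degree f"
    and hg: "in_sum f (h * g)"
  shows "\<exists>h'. lead_coeff h' = 1 \<and> degree h' = degree h \<and> f dvd h' * g"
  using h(2)
proof (rule inc_induct)
  show "\<exists>h'. lead_coeff h' = 1 \<and> degree h' = degree f \<and> f dvd h' * g" using f by auto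
next
  fix k assume k: "degree h \<le> k" "k < degree f"
    and "\<exists>h'. lead_coeff h' = 1 \<and> degree h' = Suc k \<and> f dvd h' * g"
  then obtain h1 where h1: "lead_coeff h1 = 1" "degree h1 = Suc k" "f dvd h1 * g" by blast
  obtain m where m: "coeffs_in m" "f dvd h * g - m" using hg unfolding in_sum_def by blast
  define T where "T = Polynomial.monom (1::'a) (k - degree h)"
  obtain q r where qr: "T * m = h1 * q + r" and r: "\<forall>i\<ge>degree h1. coeff r i = 0" "coeffs_in r"
    using monic_division[OF h1(1), of "T * m"] coeffs_in_mult[OF m(1)] by blast
  define c where "c = T * h - r"
  (* Modulo f, T*h*g = T*h*g*g = T*m*g because g is idempotent, and T*m*g = r*g because h1
     kills g. The coefficient of c at k is 1 minus an element of I, hence a unit. *)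
  have "f dvd - T * h * (g * g - g) + T * g * (h * g - m) + q * (h1 * g)"
    by (rule dvd_add[OF dvd_add[OF dvd_mult[OF idem] dvd_mult[OF m(2)]] dvd_mult[OF h1(3)]])
  also have "- T * h * (g * g - g) + T * g * (h * g - m) + q * (h1 * g)
      = T * h * g - (T * m - h1 * q) * g" by (simp add: algebra_simps)
  also have "\<dots> = c * g" unfolding qr c_def by (simp add: algebra_simps)
  finally have cg: "f dvd c * g" .
  have Th: "coeff (T * h) i = (if i < k - degree h then 0 else coeff h (i - (k - degree h)))" for i
    unfolding T_def by (simp add: coeff_monom_mult)
  have ck: "coeff c k = 1 - coeff r k" using h(1) k(1) by (simp add: c_def Th)
  have "coeff r k \<in> I" using r(2) by (simp add: coeffs_in_def)
  then have "coeff c k \<notin> I" using ck one_notin add_mem[of "coeff c k" "coeff r k"] by auto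
  then obtain w where w: "1 = coeff c k * w" using unit by (meson dvdE)
  have "coeff c i = 0" if "i > k" for i
  proof -
    have "i - (k - degree h) > degree h" using that k(1) by simp
    then show ?thesis using r(1) h1(2) that by (simp add: c_def Th coeff_eq_0)
  qed
  then have "degree (smult w c) = k \<and> lead_coeff (smult w c) = 1"
    using w by (intro degree_lead_coeff_eqI) (auto simp: mult.commute)
  moreover have "f dvd smult w c * g" using cg by (simp add: dvd_smult)
  ultimately show "\<exists>h'. lead_coeff h' = 1 \<and> degree h' = k \<and> f dvd h' * g" by blast
qed

text \<open>A polynomial outside \<open>I[t]\<close> has, up to a unit and modulo \<open>I[t]\<close>, a monic representative: cut it off
  above its last coefficient outside \<open>I\<close>. This replaces normalization over the residue field.\<close>
lemma monic_part:
  fixes r :: "'a poly"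
  assumes r: "\<not> coeffs_in r" "\<forall>i\<ge>d. coeff r i = 0"
  shows "\<exists>h w. lead_coeff h = 1 \<and> degree h < d \<and> coeffs_in (smult w r - h)"
proof -
  define J where "J = {i. coeff r i \<notin> I}"
  have sub: "J \<subseteq> {..<d}" using r(2) zero_mem by (force simp: J_def not_less[symmetric])
  then have fin: "finite J" by (rule finite_subset) simp
  have "J \<noteq> {}" using r(1) by (auto simp: J_def coeffs_in_def)
  define j where "j = Max J"
  have jJ: "j \<in> J" unfolding j_def using fin \<open>J \<noteq> {}\<close> by (rule Max_in)
  have above: "coeff r i \<in> I" if "i > j" for i
    using that Max_ge[OF fin, of i] by (force simp: j_def J_def)
  obtain w where w: "1 = coeff r j * w" using jJ unit[of "coeff r j"] unfolding J_def by (metis dvdE mem_Collect_eq)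
  define h where "h = smult w (poly_cutoff (Suc j) r)"
  have "degree h = j \<and> lead_coeff h = 1"
    using w by (intro degree_lead_coeff_eqI) (auto simp: h_def coeff_poly_cutoff mult.commute)
  moreover have "j < d" using jJ sub by auto
  moreover have "coeffs_in (smult w r - h)"
    using above by (auto simp: coeffs_in_def h_def coeff_poly_cutoff zero_mem intro!: mult_mem)
  ultimately show ?thesis by blast
qed

text \<open>Factor first over the residue field and then lift. There let \<open>h\<close> be the monic generator of the annihilator
  of \<open>g\<close> modulo \<open>f\<close>, and \<open>f = h q\<close>. As \<open>1 - g\<close> annihilates \<open>g\<close>, it is a multiple of \<open>h\<close>, whence \<open>q\<close>
  annihilates \<open>1 - g\<close>. Lifting gives monic \<open>f\<^sub>0\<close>, \<open>f\<^sub>1\<close> of the degrees of \<open>h\<close>, \<open>q\<close> with \<open>f\<close> dividing \<open>f\<^sub>0 g\<close> and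
  \<open>f\<^sub>1 (1 - g)\<close>. Then \<open>f\<close> divides \<open>f\<^sub>0 f\<^sub>1 g + f\<^sub>0 f\<^sub>1 (1 - g) = f\<^sub>0 f\<^sub>1\<close>, and the degrees agree.\<close>
theorem idempotent_factorization:
  fixes f g :: "'a poly"
  assumes f: "lead_coeff f = 1" and idem: "f dvd g * g - g"
  shows "\<exists>f0 f1. f = f0 * f1 \<and> lead_coeff f0 = 1 \<and> lead_coeff f1 = 1 \<and> f1 dvd g \<and> f0 dvd 1 - g"
proof -
  define P where "P h \<longleftrightarrow> lead_coeff h = 1 \<and> in_sum f (h * g)" for h
  have Pf: "P f" using f by (simp add: P_def in_sum_dvd)
  obtain h where h: "lead_coeff h = 1" "in_sum f (h * g)"
    and minimal: "\<And>h'. P h' \<Longrightarrow> degree h \<le> degree h'"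
    using ex_has_least_nat[of P f degree, OF Pf] by (auto simp: P_def)
  have hf: "degree h \<le> degree f" using minimal[OF Pf] .
  (* The reduction of h generates the annihilator of g: by minimality a remainder has no unit
     coefficient. *)
  have ann: "coeffs_in r" if p: "in_sum f (p * g)" "p = h * q + r" "\<forall>i\<ge>degree h. coeff r i = 0" for p q r
  proof (rule ccontr)
    assume "\<not> coeffs_in r"
    from monic_part[OF this p(3)] obtain h' w where
      h': "lead_coeff h' = 1" "degree h' < degree h" "coeffs_in (smult w r - h')" by blast
    have "in_sum f (p * g - q * (h * g))" by (rule in_sum_diff[OF p(1) in_sum_mult[OF h(2)]])
    then have "in_sum f (r * g)" unfolding p(2) by (simp add: algebra_simps)
    then have "in_sum f ([:w:] * (r * g) - g * (smult w r - h'))"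
      by (rule in_sum_diff[OF in_sum_mult in_sum_coeffs[OF coeffs_in_mult[OF h'(3)]]])
    then have "in_sum f (h' * g)" by (simp add: algebra_simps)
    then show False using minimal[of h'] h' by (simp add: P_def)
  qed
  obtain q r where qr: "f = h * q + r" "\<forall>i\<ge>degree h. coeff r i = 0"
    using monic_division[OF h(1), of f] by blast
  have rI: "coeffs_in r" using ann[of f q r] Pf qr by (simp add: P_def)
  have hq: "degree (h * q) = degree f \<and> lead_coeff (h * q) = 1"
  proof (rule degree_lead_coeff_eqI)
    have "h * q = f - r" using qr(1) by simp
    then show "coeff (h * q) (degree f) = 1" "\<And>i. i > degree f \<Longrightarrow> coeff (h * q) i = 0"
      using qr(2) hf f by (auto simp: coeff_eq_0)
  qed
  have "q \<noteq> 0" using hq by auto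
  then have dq: "degree f = degree h + degree q"
    using hq degree_monic_mult[OF h(1), of q] by simp
  have q1: "lead_coeff q = 1" using lcoeff_monic_mult[OF h(1), of q] conjunct2[OF hq] conjunct1[OF hq] dq by simp
  obtain w s where ws: "1 - g = h * w + s" "\<forall>i\<ge>degree h. coeff s i = 0"
    using monic_division[OF h(1), of "1 - g"] by blast
  have "f dvd (1 - g) * g" using dvd_minus_iff[of f "g * g - g"] idem by (simp add: algebra_simps)
  then have sI: "coeffs_in s" by (rule ann[OF in_sum_dvd ws])
  have "in_sum f (w * f - (w * r - q * s))"
    by (rule in_sum_diff[OF in_sum_mult[OF in_sum_dvd[OF dvd_refl]]
          in_sum_coeffs[OF coeffs_in_diff[OF coeffs_in_mult[OF rI] coeffs_in_mult[OF sI]]]])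
  also have "w * f - (w * r - q * s) = q * (1 - g)"
    unfolding qr(1) ws(1) by (simp add: algebra_simps)
  finally have qg: "in_sum f (q * (1 - g))" .
  have idem': "f dvd (1 - g) * (1 - g) - (1 - g)" using idem by (simp add: algebra_simps)
  obtain f0 where f0: "lead_coeff f0 = 1" "degree f0 = degree h" "f dvd f0 * g"
    using nakayama_annihilator[OF f idem h(1) hf h(2)] by blast
  obtain f1 where f1: "lead_coeff f1 = 1" "degree f1 = degree q" "f dvd f1 * (1 - g)"
    using nakayama_annihilator[OF f idem' q1 _ qg] dq by auto
  have "f dvd f1 * (f0 * g) + f0 * (f1 * (1 - g))" by (rule dvd_add[OF dvd_mult[OF f0(3)] dvd_mult[OF f1(3)]])
  then have "f dvd f0 * f1" by (simp add: algebra_simps)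
  then have fac: "f = f0 * f1"
    using degree_mult_monic[OF f0(1) f1(1)] f dq f0(2) f1(2)
    by (intro monic_dvd_monic_same_degree) auto
  have "f1 dvd g" using monic_mult_dvd_cancel[OF f0(1)] f0(3) fac by blast
  moreover have "f0 dvd 1 - g"
    using monic_mult_dvd_cancel[OF f1(1), of f0 "1 - g"] f1(3) fac by (simp add: mult.commute)
  ultimately show ?thesis using fac f0(1) f1(1) by blast
qed

end

section \<open>Strongly clean roots and SRC factorizations\<close>

text \<open>The class of \<open>t\<close> in \<open>R[t]/(f)\<close> is strongly clean: \<open>g\<close> represents the idempotent and \<open>v\<close> the inverse of
  the unit \<open>t - g\<close>. The quotient ring is commutative, so \<open>g\<close> and \<open>t - g\<close> commute.\<close>
definition strongly_clean_root :: "'a::comm_ring_1 poly \<Rightarrow> bool" where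
  "strongly_clean_root f \<longleftrightarrow> (\<exists>g v. f dvd g * g - g \<and> f dvd ([:0, 1:] - g) * v - 1)"

text \<open>Modulo \<open>f\<^sub>1\<close> the idempotent \<open>g\<close> is \<open>0\<close>, so \<open>t v \<equiv> 1\<close>, and evaluation at \<open>0\<close> exhibits \<open>f\<^sub>1(0)\<close> as a unit;
  modulo \<open>f\<^sub>0\<close> it is \<open>1\<close>, and evaluation at \<open>1\<close> exhibits \<open>f\<^sub>0(1)\<close> as one.\<close>
lemma (in local_ideal) SRC_factorization_if_strongly_clean_root:
  fixes f :: "'a poly"
  assumes f: "lead_coeff f = 1" and "strongly_clean_root f"
  shows "\<exists>f0 f1. SRC_factorization f f0 f1"
proof -
  obtain g v where g: "f dvd g * g - g" and v: "f dvd ([:0, 1:] - g) * v - 1"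
    using assms(2) unfolding strongly_clean_root_def by blast
  obtain f0 f1 where fac: "f = f0 * f1" "lead_coeff f0 = 1" "lead_coeff f1 = 1"
    and f1: "f1 dvd g" and f0: "f0 dvd 1 - g"
    using idempotent_factorization[OF f g] by blast
  have v0: "f0 dvd ([:0, 1:] - g) * v - 1" and v1: "f1 dvd ([:0, 1:] - g) * v - 1"
    using v unfolding fac(1) by (rule dvd_mult_left, rule dvd_mult_right)
  have "f1 dvd (([:0, 1:] - g) * v - 1) + g * v"
    using f1 v1 by (intro dvd_add dvd_mult2)
  then have "f1 dvd [:0, 1:] * v - 1" by (simp add: algebra_simps)
  then obtain c where "[:0, 1:] * v - 1 = f1 * c" by (rule dvdE)
  from arg_cong[OF this, of "\<lambda>p. poly p 0"] have u1: "poly f1 0 dvd 1"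
    by (auto simp: minus_equation_iff[of 1] intro!: dvdI[of _ _ "- poly c 0"])
  have "f0 dvd (([:0, 1:] - g) * v - 1) - (1 - g) * v"
    by (rule dvd_diff[OF v0 dvd_mult2[OF f0]])
  also have "(([:0, 1:] - g) * v - 1) - (1 - g) * v = ([:0, 1:] - 1) * v - 1"
    by (simp add: algebra_simps)
  finally obtain d where "([:0, 1:] - 1) * v - 1 = f0 * d" by (rule dvdE)
  from arg_cong[OF this, of "\<lambda>p. poly p 1"] have u0: "poly f0 1 dvd 1"
    by (auto simp: minus_equation_iff[of 1] intro!: dvdI[of _ _ "- poly d 1"])
  obtain a b where ab: "g = f1 * a" "1 - g = f0 * b" using f0 f1 by (meson dvdE)
  have one: "f0 * b + f1 * a = 1" using ab(1) ab(2)[symmetric] by simp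
  have "unimodular f0 f1" unfolding unimodular_def
  proof (intro equalityI subset_UNIV subsetI)
    fix x
    have "x = (f0 * b + f1 * a) * x" by (simp add: one)
    then have "x = f0 * (b * x) + f1 * (a * x)" by (simp add: distrib_right mult.assoc)
    then show "x \<in> {f0 * p + f1 * q | p q. True}" by blast
  qed
  moreover have "SR_factorization f f0 f1"
    unfolding SR_factorization_def using fac u0 u1
    by (intro conjI exI[of _ 1] exI[of _ 0]) auto
  ultimately show ?thesis unfolding SRC_factorization_def by blast
qed

text \<open>By the Chinese remainder theorem the inverse \<open>v\<close> may be found modulo each factor. With
  \<open>f\<^sub>1 = f\<^sub>1(0) + t h\<^sub>1\<close>, the inverse of \<open>t\<close> modulo \<open>f\<^sub>1\<close> is \<open>- h\<^sub>1 / f\<^sub>1(0)\<close>; likewise with \<open>f\<^sub>0 = f\<^sub>0(1) + (t - 1) h\<^sub>0\<close>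
  for \<open>t - 1\<close> modulo \<open>f\<^sub>0\<close>.\<close>
lemma strongly_clean_root_if_coprime_factors:
  fixes f0 f1 :: "'a::comm_ring_1 poly"
  assumes pq: "f0 * p + f1 * q = 1" and u0: "poly f0 1 dvd 1" and u1: "poly f1 0 dvd 1"
  shows "strongly_clean_root (f0 * f1)"
proof -
  obtain c0 c1 where c: "1 = poly f0 1 * c0" "1 = poly f1 0 * c1" using u0 u1 by (meson dvdE)
  define C0 C1 where "C0 = [:c0:]" and "C1 = [:c1:]"
  define h0 h1 where "h0 = synthetic_div f0 1" and "h1 = synthetic_div f1 0"
  define t where "t = [:0, 1::'a:]"
  have e0: "C0 * f0 = C0 * (t - 1) * h0 + 1"
  proof -
    have "f0 = (t - 1) * h0 + [:poly f0 1:]"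
      using synthetic_div_correct'[of 1 f0] by (simp add: h0_def t_def one_pCons)
    moreover have "C0 * [:poly f0 1:] = 1" using c by (simp add: C0_def mult.commute one_pCons)
    ultimately show ?thesis by (metis distrib_left mult.assoc)
  qed
  have e1: "C1 * f1 = C1 * t * h1 + 1"
  proof -
    have "f1 = t * h1 + [:poly f1 0:]"
      using synthetic_div_correct'[of 0 f1] by (simp add: h1_def t_def)
    moreover have "C1 * [:poly f1 0:] = 1" using c by (simp add: C1_def mult.commute one_pCons)
    ultimately show ?thesis by (metis distrib_left mult.assoc)
  qed
  define g where "g = f1 * q"
  have g': "1 - g = f0 * p" using pq by (simp add: g_def algebra_simps)
  have gg: "g * (1 - g) = f0 * f1 * (p * q)" unfolding g' by (simp add: g_def algebra_simps)
  define v where "v = - C1 * h1 * (1 - g) - C0 * h0 * g"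
  have "g * g - g = f0 * f1 * (- p * q)" using gg by (simp add: algebra_simps)
  then have "f0 * f1 dvd g * g - g" by (metis dvd_triv_left)
  moreover have "f0 * f1 dvd (t - g) * v - 1"
  proof -
    have "(t - g) * v - 1 =
       - (C1 * t * h1 + 1) * (1 - g) - (C0 * (t - 1) * h0 + 1) * g
       + (C1 * h1 - C0 * h0) * (g * (1 - g))"
      unfolding v_def by (simp add: algebra_simps)
    also have "\<dots> = - (C1 * f1) * (f0 * p) - (C0 * f0) * (f1 * q)
       + (C1 * h1 - C0 * h0) * (f0 * f1 * (p * q))"
      using e0 e1 g' gg by (simp add: g_def[symmetric])
    also have "\<dots> = f0 * f1 * (- C1 * p - C0 * q + (C1 * h1 - C0 * h0) * (p * q))"
      by (simp add: algebra_simps)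
    finally show ?thesis by (metis dvd_triv_left)
  qed
  ultimately show ?thesis unfolding strongly_clean_root_def t_def by blast
qed

lemma (in local_ideal) idempotent_trivial:
  fixes e :: 'a
  assumes "e * e = e" shows "e = 0 \<or> e = 1"
proof (cases "e \<in> I")
  case True
  then have "1 - e \<notin> I" using one_notin add_mem[of "1 - e" e] by auto
  then obtain w where "1 = (1 - e) * w" using unit by (meson dvdE)
  then have "e = e * (1 - e) * w" by (metis mult.assoc mult.right_neutral)
  then show ?thesis using assms by (simp add: algebra_simps)
next
  case False
  then obtain w where w: "1 = e * w" using unit by (meson dvdE)
  then have "e = e * e * w" by (metis mult.assoc mult.right_neutral)
  then show ?thesis using assms w by simp
qed

text \<open>The two idempotents are \<open>0\<close> and \<open>1\<close> in some order; exchanging \<open>f\<^sub>0\<close> and \<open>f\<^sub>1\<close>, which keeps \<open>f\<close> and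
  unimodularity, reduces to the order treated above.\<close>
lemma (in local_ideal) strongly_clean_root_if_SRC_factorization:
  fixes f f0 f1 :: "'a poly"
  assumes "SRC_factorization f f0 f1"
  shows "strongly_clean_root f"
proof -
  obtain e0 e1 where fac: "f = f0 * f1" and e: "e0 * e0 = e0" "e1 * e1 = e1" "e0 \<noteq> e1"
    and u: "poly f0 e0 dvd 1" "poly f1 e1 dvd 1" and "unimodular f0 f1"
    using assms unfolding SRC_factorization_def SR_factorization_def by blast
  then obtain p q where pq: "f0 * p + f1 * q = 1" unfolding unimodular_def by (auto simp: set_eq_iff dest!: spec[of _ 1])
  have "e0 = 1 \<and> e1 = 0 \<or> e0 = 0 \<and> e1 = 1" using e idempotent_trivial by blast
  then show ?thesis
  proof
    assume "e0 = 1 \<and> e1 = 0"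
    then show ?thesis using strongly_clean_root_if_coprime_factors[OF pq] u fac by simp
  next
    assume "e0 = 0 \<and> e1 = 1"
    then show ?thesis
      using strongly_clean_root_if_coprime_factors[of f1 q f0 p] pq u fac
      by (simp add: mult.commute add.commute)
  qed
qed

section \<open>Evaluating polynomials at a matrix\<close>

text \<open>The Horner scheme, so that induction along \<^const>\<open>pCons\<close> applies directly.\<close>
definition mat_poly :: "'a::comm_ring_1 mat \<Rightarrow> 'a poly \<Rightarrow> 'a mat" where
  "mat_poly A p = foldr (\<lambda>c M. c \<cdot>\<^sub>m 1\<^sub>m (dim_row A) + A * M) (Polynomial.coeffs p)
     (0\<^sub>m (dim_row A) (dim_row A))"

context
  fixes A :: "'a::comm_ring_1 mat" and n :: nat
  assumes A: "A \<in> carrier_mat n n"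
begin

lemma mat_poly_0: "mat_poly A 0 = 0\<^sub>m n n"
  using A by (simp add: mat_poly_def)

lemma mat_poly_pCons: "mat_poly A (pCons a p) = a \<cdot>\<^sub>m 1\<^sub>m n + A * mat_poly A p"
proof (cases "p = 0 \<and> a = 0")
  case True
  have "0 \<cdot>\<^sub>m 1\<^sub>m n + A * 0\<^sub>m n n = 0\<^sub>m n n" using A by (intro eq_matI) auto
  then show ?thesis using True mat_poly_0 by simp
next
  case False
  then have "Polynomial.coeffs (pCons a p) = a # Polynomial.coeffs p"
    by (auto simp: cCons_def)
  then show ?thesis using A by (simp add: mat_poly_def)
qed

lemma mat_poly_carrier: "mat_poly A p \<in> carrier_mat n n"
  by (induction p) (use A in \<open>auto simp: mat_poly_0 mat_poly_pCons\<close>)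

lemma mat_poly_add: "mat_poly A (p + q) = mat_poly A p + mat_poly A q"
proof (induction p q rule: poly_induct2)
  case 0
  then show ?case by (simp add: mat_poly_0)
next
  case (pCons a p b q)
  note c = mat_poly_carrier[of p] mat_poly_carrier[of q]
  have "A * (mat_poly A p + mat_poly A q) = A * mat_poly A p + A * mat_poly A q"
    using mult_add_distrib_mat[OF A c] .
  moreover have "A * mat_poly A p \<in> carrier_mat n n" "A * mat_poly A q \<in> carrier_mat n n"
    using A c by auto
  ultimately show ?case using A c
    by (simp only: add_pCons mat_poly_pCons pCons, intro eq_matI)
      (auto simp: algebra_simps simp del: index_mult_mat(1))
qed

lemma mat_poly_smult: "mat_poly A (smult c p) = c \<cdot>\<^sub>m mat_poly A p"
proof (induction p)
  case 0
  then show ?case by (simp add: mat_poly_0)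
next
  case (pCons a p)
  note m = mat_poly_carrier[of p]
  have "A * (c \<cdot>\<^sub>m mat_poly A p) = c \<cdot>\<^sub>m (A * mat_poly A p)"
    using mult_smult_distrib[OF A m] .
  moreover have "A * mat_poly A p \<in> carrier_mat n n" using A m by auto
  ultimately show ?case using A m
    by (simp only: smult_pCons mat_poly_pCons pCons, intro eq_matI)
      (auto simp: algebra_simps simp del: index_mult_mat(1))
qed

lemma mat_poly_mult: "mat_poly A (p * q) = mat_poly A p * mat_poly A q"
proof (induction p)
  case 0
  then show ?case using mat_poly_carrier[of q] by (simp add: mat_poly_0)
next
  case (pCons a p)
  note P = mat_poly_carrier[of p] and Q = mat_poly_carrier[of q]
  have "mat_poly A (pCons a p * q)
      = a \<cdot>\<^sub>m mat_poly A q + (0 \<cdot>\<^sub>m 1\<^sub>m n + A * (mat_poly A p * mat_poly A q))"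
    by (simp add: mat_poly_add mat_poly_smult mat_poly_pCons pCons)
  also have "0 \<cdot>\<^sub>m 1\<^sub>m n + A * (mat_poly A p * mat_poly A q) = A * mat_poly A p * mat_poly A q"
  proof -
    have "A * (mat_poly A p * mat_poly A q) \<in> carrier_mat n n" using A P Q by auto
    then have "0 \<cdot>\<^sub>m 1\<^sub>m n + A * (mat_poly A p * mat_poly A q) = A * (mat_poly A p * mat_poly A q)"
      using A P Q by (intro eq_matI) (auto simp del: index_mult_mat(1))
    then show ?thesis using assoc_mult_mat[OF A P Q] by simp
  qed
  also have "a \<cdot>\<^sub>m mat_poly A q = (a \<cdot>\<^sub>m 1\<^sub>m n) * mat_poly A q"
    using mult_smult_assoc_mat[OF one_carrier_mat Q] Q by simp
  also have "(a \<cdot>\<^sub>m 1\<^sub>m n) * mat_poly A q + A * mat_poly A p * mat_poly A q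
      = (a \<cdot>\<^sub>m 1\<^sub>m n + A * mat_poly A p) * mat_poly A q"
    using A P Q by (intro add_mult_distrib_mat[symmetric, of _ n n]) auto
  finally show ?case by (simp add: mat_poly_pCons)
qed

lemma mat_poly_const: "mat_poly A [:c:] = c \<cdot>\<^sub>m 1\<^sub>m n"
  using A by (simp add: mat_poly_pCons mat_poly_0)

lemma mat_poly_1: "mat_poly A 1 = 1\<^sub>m n"
  unfolding one_pCons mat_poly_const by (intro eq_matI) auto

lemma mat_poly_X: "mat_poly A [:0, 1:] = A"
proof -
  have "0 \<cdot>\<^sub>m 1\<^sub>m n + A = A" using A by (intro eq_matI) auto
  moreover have "1 \<cdot>\<^sub>m 1\<^sub>m n = (1\<^sub>m n :: 'a mat)" by (intro eq_matI) auto
  ultimately show ?thesis using A mat_poly_pCons[of 0 "[:1:]"] by (simp only: mat_poly_const) simp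
qed

lemma mat_poly_sum_index:
  assumes "i < n" "j < n"
  shows "mat_poly A (\<Sum>l\<in>S. p l) $$ (i, j) = (\<Sum>l\<in>S. mat_poly A (p l) $$ (i, j))"
proof (induction S rule: infinite_finite_induct)
  case (insert x F)
  then show ?case using assms mat_poly_carrier[of "p x"] mat_poly_carrier[of "\<Sum>l\<in>F. p l"]
    by (simp add: mat_poly_add)
qed (use assms in \<open>auto simp: mat_poly_0\<close>)

text \<open>The determinant trick. View \<open>T = t 1 - A\<close> as a matrix over \<open>R[t]\<close> and let \<open>B\<close> be its adjugate, so that
  \<open>T B\<close> is the characteristic polynomial times the identity. Let \<open>R[t]\<close> act on \<open>R\<^sup>n\<close>, with \<open>t\<close> acting as \<open>A\<close>. The identity \<open>A e\<^sub>l = \<Sum>\<^sub>k A\<^sub>k\<^sub>l e\<^sub>k\<close>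
  says that \<open>\<Sum>\<^sub>k T\<^sub>k\<^sub>l e\<^sub>k = 0\<close>. Multiplying by \<open>B\<^sub>l\<^sub>j\<close> and summing over \<open>l\<close> leaves the characteristic polynomial
  applied to \<open>e\<^sub>j\<close>.\<close>
theorem cayley_hamilton: "mat_poly A (char_poly A) = 0\<^sub>m n n"
proof (rule eq_matI)
  fix i j assume "i < dim_row (0\<^sub>m n n)" "j < dim_col (0\<^sub>m n n)"
  then have ij: "i < n" "j < n" by auto
  define T where "T = char_poly_matrix A"
  have T: "T \<in> carrier_mat n n" using A by (simp add: T_def)
  have Xkl: "T $$ (k, l) = [:- A $$ (k, l), if k = l then 1 else 0:]" if "k < n" "l < n" for k l
    using that A by (auto simp: T_def char_poly_matrix_def)
  define B where "B = adj_mat T"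
  have B: "B \<in> carrier_mat n n" using adj_mat[OF T] by (simp add: B_def)
  have XB: "(\<Sum>l=0..<n. T $$ (k, l) * B $$ (l, j)) = (if k = j then char_poly A else 0)"
    if k: "k < n" for k
  proof -
    have "(T * B) $$ (k, j) = (det T \<cdot>\<^sub>m 1\<^sub>m n) $$ (k, j)" using adj_mat(2)[OF T] by (simp add: B_def)
    then show ?thesis using k ij T B by (simp add: scalar_prod_def char_poly_def T_def)
  qed
  have Xsum: "(\<Sum>k=0..<n. mat_poly A (T $$ (k, l)) $$ (s, k)) = 0" if "s < n" "l < n" for s l
  proof -
    have "mat_poly A (T $$ (k, l)) $$ (s, k)
        = (if k = l then A $$ (s, l) else 0) - (if k = s then A $$ (s, l) else 0)"
      if "k < n" for k
    proof -
      have "mat_poly A (T $$ (k, l))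
         = - A $$ (k, l) \<cdot>\<^sub>m 1\<^sub>m n + (if k = l then 1 else 0) \<cdot>\<^sub>m A"
        unfolding Xkl[OF that \<open>l < n\<close>] mat_poly_pCons[of _ "[:_:]"] mat_poly_const
        using mult_smult_distrib[OF A one_carrier_mat] A by simp
      then show ?thesis using \<open>k < n\<close> \<open>s < n\<close> A by auto
    qed
    then show ?thesis using that by (simp add: sum_subtractf)
  qed
  have "mat_poly A (char_poly A) $$ (i, j)
      = (\<Sum>k=0..<n. if k = j then mat_poly A (char_poly A) $$ (i, k) else 0)"
    using ij by simp
  also have "\<dots> = (\<Sum>k=0..<n. mat_poly A (if k = j then char_poly A else 0) $$ (i, k))"
    using ij by (intro sum.cong) (auto simp: mat_poly_0)
  also have "\<dots> = (\<Sum>k=0..<n. mat_poly A (\<Sum>l=0..<n. B $$ (l, j) * T $$ (k, l)) $$ (i, k))"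
    using XB by (intro sum.cong) (auto simp: mult.commute)
  also have "\<dots> = (\<Sum>k=0..<n. \<Sum>l=0..<n. \<Sum>s=0..<n.
      mat_poly A (B $$ (l, j)) $$ (i, s) * mat_poly A (T $$ (k, l)) $$ (s, k))"
  proof (intro sum.cong refl)
    fix k assume k: "k \<in> {0..<n}"
    then have k: "k < n" by simp
    have "mat_poly A (p * q) $$ (i, k) = (\<Sum>s=0..<n. mat_poly A p $$ (i, s) * mat_poly A q $$ (s, k))"
      for p q
      using ij k mat_poly_carrier[of p] mat_poly_carrier[of q]
      by (simp add: mat_poly_mult scalar_prod_def)
    then show "mat_poly A (\<Sum>l=0..<n. B $$ (l, j) * T $$ (k, l)) $$ (i, k)
      = (\<Sum>l=0..<n. \<Sum>s=0..<n. mat_poly A (B $$ (l, j)) $$ (i, s) * mat_poly A (T $$ (k, l)) $$ (s, k))"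
      using ij k by (simp add: mat_poly_sum_index)
  qed
  also have "\<dots> = (\<Sum>l=0..<n. \<Sum>s=0..<n. mat_poly A (B $$ (l, j)) $$ (i, s) *
      (\<Sum>k=0..<n. mat_poly A (T $$ (k, l)) $$ (s, k)))"
    unfolding sum_distrib_left
    by (subst sum.swap, rule sum.cong[OF refl], rule sum.swap)
  also have "\<dots> = 0" using Xsum by simp
  finally show "mat_poly A (char_poly A) $$ (i, j) = 0\<^sub>m n n $$ (i, j)" using ij by simp
qed (use mat_poly_carrier in auto)

lemma mat_poly_cong:
  assumes "char_poly A dvd p - q"
  shows "mat_poly A p = mat_poly A q"
proof -
  obtain c where "p - q = char_poly A * c" using assms by (rule dvdE)
  then have "p = char_poly A * c + q" by (simp add: algebra_simps)
  then have "mat_poly A p = 0\<^sub>m n n * mat_poly A c + mat_poly A q"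
    by (simp add: mat_poly_add mat_poly_mult cayley_hamilton)
  then show ?thesis using mat_poly_carrier[of c] mat_poly_carrier[of q] by simp
qed

text \<open>By Cayley-Hamilton, evaluation at \<open>A\<close> factors through \<open>R[t]/(f)\<close>, \<open>f\<close> the characteristic polynomial, and
  a ring homomorphism preserves strongly clean decompositions.\<close>
lemma strongly_clean_if_strongly_clean_root:
  assumes "strongly_clean_root (char_poly A)"
  shows "strongly_clean (ring_mat TYPE('a) n b) A"
proof -
  obtain g v where g: "char_poly A dvd g * g - g" and v: "char_poly A dvd ([:0, 1:] - g) * v - 1"
    using assms unfolding strongly_clean_root_def by blast
  define E U V where "E = mat_poly A g" and "U = mat_poly A ([:0, 1:] - g)" and "V = mat_poly A v"
  have "E * E = E" using mat_poly_cong[OF g] by (simp add: E_def mat_poly_mult)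
  moreover have "E * U = U * E"
    unfolding E_def U_def mat_poly_mult[symmetric] by (simp add: mult.commute)
  moreover have "A = E + U"
    unfolding E_def U_def mat_poly_add[symmetric] by (simp add: mat_poly_X)
  moreover have "U * V = 1\<^sub>m n" using mat_poly_cong[OF v] by (simp add: U_def V_def mat_poly_mult mat_poly_1)
  moreover have "V * U = U * V"
    unfolding V_def U_def mat_poly_mult[symmetric] by (simp add: mult.commute)
  moreover have "E \<in> carrier_mat n n" "U \<in> carrier_mat n n" "V \<in> carrier_mat n n"
    by (auto simp: E_def U_def V_def mat_poly_carrier)
  ultimately show ?thesis unfolding strongly_clean_def ring_mat_simps Units_def
    by (intro bexI[of _ E] bexI[of _ U]) auto
qed

end

section \<open>Matrices commuting with a companion matrix\<close>

text \<open>Multiplication by \<open>t\<close> on \<open>R[t]/(f)\<close> in the basis \<open>1, t, \<dots>, t\<^sup>n\<^sup>-\<^sup>1\<close>. The last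
  column encodes \<open>t\<^sup>n \<equiv> - (f\<^sub>0 + f\<^sub>1 t + \<dots> + f\<^sub>n\<^sub>-\<^sub>1 t\<^sup>n\<^sup>-\<^sup>1)\<close>, where \<open>n\<close> is the degree and the \<open>f\<^sub>i\<close> are the coefficients of the
  monic polynomial \<open>f\<close>.\<close>
definition companion_mat :: "'a::comm_ring_1 poly \<Rightarrow> 'a mat" where
  "companion_mat f = mat (degree f) (degree f) (\<lambda>(i, j).
     (if i = Suc j then 1 else 0) - (if Suc j = degree f then coeff f i else 0))"

definition vec_poly :: "'a::comm_ring_1 vec \<Rightarrow> 'a poly" where
  "vec_poly v = Poly (list_of_vec v)"

lemma coeff_vec_poly: "coeff (vec_poly v) i = (if i < dim_vec v then v $ i else 0)"
  by (simp add: vec_poly_def nth_default_def list_of_vec_index)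

lemma vec_poly_add:
  "v \<in> carrier_vec n \<Longrightarrow> w \<in> carrier_vec n \<Longrightarrow> vec_poly (v + w) = vec_poly v + vec_poly w"
  by (intro poly_eqI) (auto simp: coeff_vec_poly)

lemma vec_poly_smult: "vec_poly (c \<cdot>\<^sub>v v) = smult c (vec_poly v)"
  by (intro poly_eqI) (auto simp: coeff_vec_poly)

text \<open>The isomorphism between \<open>R\<^sup>n\<close> and \<open>R[t]/(f)\<close>, as a relation: it avoids choosing normal
  forms for residue classes.\<close>
definition represents :: "'a::comm_ring_1 poly \<Rightarrow> 'a vec \<Rightarrow> 'a poly \<Rightarrow> bool" where
  "represents f v p \<longleftrightarrow> v \<in> carrier_vec (degree f) \<and> f dvd vec_poly v - p"

lemma represents_add:
  assumes "represents f v p" "represents f w q"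
  shows "represents f (v + w) (p + q)"
proof -
  have "f dvd (vec_poly v - p) + (vec_poly w - q)"
    using assms unfolding represents_def by (intro dvd_add) auto
  then show ?thesis using assms vec_poly_add[of v "degree f" w]
    by (simp add: represents_def algebra_simps)
qed

lemma represents_smult:
  assumes "represents f v p"
  shows "represents f (c \<cdot>\<^sub>v v) (smult c p)"
  using assms by (simp add: represents_def vec_poly_smult smult_diff_right[symmetric] dvd_smult)

lemma represents_dvd_diff:
  assumes "represents f v p" "represents f v q"
  shows "f dvd p - q"
proof -
  have "f dvd (vec_poly v - q) - (vec_poly v - p)"
    using assms unfolding represents_def by (blast intro: dvd_diff)
  then show ?thesis by simp
qed

lemma represents_unique:
  assumes f: "lead_coeff f = 1" and "represents f v p" "represents f w p"
  shows "v = w"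
proof -
  have v: "v \<in> carrier_vec (degree f)" and w: "w \<in> carrier_vec (degree f)"
    using assms by (auto simp: represents_def)
  have "f dvd (vec_poly v - p) - (vec_poly w - p)"
    using assms unfolding represents_def by (blast intro: dvd_diff)
  then have "f dvd vec_poly v - vec_poly w" by simp
  then obtain c where c: "vec_poly v - vec_poly w = f * c" by (rule dvdE)
  have "c = 0"
  proof (rule ccontr)
    assume "c \<noteq> 0"
    then have "coeff (f * c) (degree f + degree c) \<noteq> 0" using lcoeff_monic_mult[OF f, of c] by simp
    then show False using v w unfolding c[symmetric] by (simp add: coeff_vec_poly)
  qed
  then have "vec_poly v = vec_poly w" using c by simp
  show "v = w"
  proof (rule eq_vecI)
    fix i assume "i < dim_vec w"
    then show "v $ i = w $ i"
      using arg_cong[OF \<open>vec_poly v = vec_poly w\<close>, of "\<lambda>p. coeff p i"] v w by (simp add: coeff_vec_poly)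
  qed (use v w in auto)
qed

lemma companion_mat_carrier: "companion_mat f \<in> carrier_mat (degree f) (degree f)"
  by (simp add: companion_mat_def)

lemma represents_companion_mat:
  fixes f :: "'a::comm_ring_1 poly"
  assumes f: "lead_coeff f = 1" "degree f > 0" and v: "represents f v p"
  shows "represents f (companion_mat f *\<^sub>v v) (pCons 0 p)"
proof -
  define n where "n = degree f"
  obtain m where m: "n = Suc m" using f(2) by (cases n) (auto simp: n_def)
  have vc: "v \<in> carrier_vec n" using v by (simp add: represents_def n_def)
  have entry: "(companion_mat f *\<^sub>v v) $ i = (if i = 0 then 0 else v $ (i - 1)) - coeff f i * v $ m"
    if i: "i < n" for i
  proof -
    have "(companion_mat f *\<^sub>v v) $ i =
       (\<Sum>j=0..<n. ((if i = Suc j then 1 else 0) - (if Suc j = n then coeff f i else 0)) * v $ j)"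
      using i vc by (simp add: companion_mat_def scalar_prod_def n_def)
    also have "\<dots> = (\<Sum>j=0..<n. (if i \<noteq> 0 \<and> j = i - 1 then v $ j else 0)
         - (if j = m then coeff f i * v $ j else 0))"
      by (intro sum.cong) (auto simp: m left_diff_distrib)
    also have "\<dots> = (if i = 0 then 0 else v $ (i - 1)) - coeff f i * v $ m"
      using i m by (cases "i = 0") (auto simp: sum_subtractf left_diff_distrib)
    finally show ?thesis .
  qed
  have "vec_poly (companion_mat f *\<^sub>v v) = pCons 0 (vec_poly v) - smult (v $ m) f"
  proof (rule poly_eqI)
    fix i
    have d: "dim_vec (companion_mat f *\<^sub>v v) = n" by (simp add: companion_mat_def n_def)
    consider "i < n" | "i = n" | "i > n" by linarith
    then show "coeff (vec_poly (companion_mat f *\<^sub>v v)) i = coeff (pCons 0 (vec_poly v) - smult (v $ m) f) i"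
    proof cases
      case 1
      then show ?thesis using entry[OF 1] vc d
        by (cases i) (auto simp: coeff_vec_poly mult.commute simp del: index_mult_mat_vec)
    next
      case 2
      then show ?thesis using vc d m f(1)
        by (simp add: coeff_vec_poly n_def[symmetric] del: index_mult_mat_vec)
    next
      case 3
      then show ?thesis using vc d m
        by (cases i) (auto simp: coeff_vec_poly coeff_eq_0 n_def[symmetric] simp del: index_mult_mat_vec)
    qed
  qed
  then have "vec_poly (companion_mat f *\<^sub>v v) - pCons 0 p
      = [:0, 1:] * (vec_poly v - p) + f * [:- (v $ m):]"
    by (simp add: algebra_simps)
  moreover have "f dvd [:0, 1:] * (vec_poly v - p) + f * [:- (v $ m):]"
    using v unfolding represents_def by (intro dvd_add[OF dvd_mult dvd_triv_left]) auto
  ultimately show ?thesis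
    using companion_mat_carrier[of f] vc by (auto simp: represents_def n_def)
qed

lemma represents_unit_vec:
  fixes f :: "'a::comm_ring_1 poly"
  assumes "degree f > 0"
  shows "represents f (unit_vec (degree f) 0) 1"
proof -
  have "vec_poly (unit_vec (degree f) 0) = (1 :: 'a poly)"
    using assms by (intro poly_eqI) (auto simp: coeff_vec_poly coeff_1 unit_vec_def)
  then show ?thesis by (simp add: represents_def)
qed

text \<open>\<open>R[t]/(f)\<close> is a cyclic module, so an endomorphism is determined by the image \<open>g\<close> of \<open>1\<close> and is
  multiplication by \<open>g\<close>.\<close>
lemma commuting_mat_represents_mult:
  fixes f :: "'a::comm_ring_1 poly"
  assumes f: "lead_coeff f = 1" "degree f > 0"
    and E: "E \<in> carrier_mat (degree f) (degree f)"
    and comm: "E * companion_mat f = companion_mat f * E"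
    and g: "g = vec_poly (E *\<^sub>v unit_vec (degree f) 0)"
    and v: "represents f v p"
  shows "represents f (E *\<^sub>v v) (g * p)"
proof -
  define n e where "n = degree f" and "e = (unit_vec n 0 :: 'a vec)"
  note C = companion_mat_carrier[of f, folded n_def] and E = E[folded n_def]
  have e: "e \<in> carrier_vec n" "represents f e 1"
    using represents_unit_vec[OF f(2)] by (simp_all add: e_def n_def)
  have Ee: "represents f (E *\<^sub>v e) g"
    using E by (simp add: represents_def g n_def[symmetric] e_def)
  have "\<exists>w. represents f w p \<and> represents f (E *\<^sub>v w) (g * p)"
  proof (induction p)
    case 0
    have "vec_poly (0\<^sub>v n) = (0 :: 'a poly)"
      by (intro poly_eqI) (auto simp: coeff_vec_poly)
    then have "represents f (0\<^sub>v n) 0" by (simp add: represents_def n_def)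
    moreover have "E *\<^sub>v 0\<^sub>v n = 0\<^sub>v n" using E by (intro eq_vecI) auto
    ultimately show ?case by (intro exI[of _ "0\<^sub>v n"]) simp
  next
    case (pCons c p)
    then obtain w where w: "represents f w p" "represents f (E *\<^sub>v w) (g * p)" by blast
    then have wc: "w \<in> carrier_vec n" by (simp add: represents_def n_def)
    define w' where "w' = c \<cdot>\<^sub>v e + companion_mat f *\<^sub>v w"
    have "represents f w' (smult c 1 + pCons 0 p)" unfolding w'_def
      by (intro represents_add represents_smult e represents_companion_mat f w)
    moreover have "E *\<^sub>v w' = c \<cdot>\<^sub>v (E *\<^sub>v e) + companion_mat f *\<^sub>v (E *\<^sub>v w)"
    proof -
      have "E *\<^sub>v w' = E *\<^sub>v (c \<cdot>\<^sub>v e) + E *\<^sub>v (companion_mat f *\<^sub>v w)"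
        unfolding w'_def using E C wc e by (intro mult_add_distrib_mat_vec[of _ n n]) auto
      also have "E *\<^sub>v (c \<cdot>\<^sub>v e) = c \<cdot>\<^sub>v (E *\<^sub>v e)" using E e(1) by (intro eq_vecI) auto
      also have "E *\<^sub>v (companion_mat f *\<^sub>v w) = companion_mat f *\<^sub>v (E *\<^sub>v w)"
        using E C wc comm by (metis assoc_mult_mat_vec)
      finally show ?thesis .
    qed
    moreover have "represents f (c \<cdot>\<^sub>v (E *\<^sub>v e) + companion_mat f *\<^sub>v (E *\<^sub>v w))
        (smult c g + pCons 0 (g * p))"
      by (intro represents_add represents_smult Ee represents_companion_mat f w)
    ultimately show ?case
      by (intro exI[of _ w']) (simp add: mult_pCons_right one_pCons)
  qed
  then show ?thesis using represents_unique[OF f(1) v] by blast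
qed

text \<open>In \<open>C = E + U\<close> the matrix \<open>E\<close> commutes with \<open>C\<close>, so it is multiplication by some \<open>g\<close>, and \<open>U\<close> is
  multiplication by \<open>t - g\<close>. The preimage of \<open>1\<close> under \<open>U\<close> is the required inverse \<open>v\<close>.\<close>
lemma strongly_clean_root_if_companion_mat:
  fixes f :: "'a::comm_ring_1 poly"
  assumes f: "lead_coeff f = 1" "degree f > 0"
    and sc: "strongly_clean (ring_mat TYPE('a) (degree f) b) (companion_mat f)"
  shows "strongly_clean_root f"
proof -
  define n e where "n = degree f" and "e = (unit_vec n 0 :: 'a vec)"
  define C where "C = companion_mat f"
  have Cc: "C \<in> carrier_mat n n" using companion_mat_carrier[of f] by (simp add: C_def n_def)
  have e: "e \<in> carrier_vec n" "represents f e 1"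
    using represents_unit_vec[OF f(2)] by (simp_all add: e_def n_def)
  obtain E U V where E: "E \<in> carrier_mat n n" and U: "U \<in> carrier_mat n n" and V: "V \<in> carrier_mat n n"
    and EE: "E * E = E" and EU: "E * U = U * E" and CEU: "C = E + U" and UV: "U * V = 1\<^sub>m n"
    using sc unfolding strongly_clean_def ring_mat_simps Units_def C_def n_def by auto
  have comm: "E * C = C * E"
    unfolding CEU using mult_add_distrib_mat[OF E E U] add_mult_distrib_mat[OF E U E] EU by simp
  define g where "g = vec_poly (E *\<^sub>v e)"
  note mult = commuting_mat_represents_mult[OF f E[unfolded n_def] comm[unfolded C_def]
      g_def[unfolded e_def n_def]]
  have "represents f (E *\<^sub>v (E *\<^sub>v e)) (g * (g * 1))" by (intro mult e)
  moreover have "E *\<^sub>v (E *\<^sub>v e) = E *\<^sub>v e" using assoc_mult_mat_vec[OF E E e(1)] EE by simp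
  moreover have "represents f (E *\<^sub>v e) (g * 1)" by (intro mult e)
  ultimately have "f dvd g * g - g" using represents_dvd_diff[of f "E *\<^sub>v e" "g * g" g] by simp
  moreover
  define w where "w = V *\<^sub>v e"
  have wc: "w \<in> carrier_vec n" using V e by (simp add: w_def)
  define v where "v = vec_poly w"
  have w: "represents f w v" using wc by (simp add: represents_def v_def n_def)
  have "f dvd ([:0, 1:] - g) * v - 1"
  proof -
    have "represents f (C *\<^sub>v w + - 1 \<cdot>\<^sub>v (E *\<^sub>v w)) (pCons 0 v + smult (- 1) (g * v))"
      unfolding C_def by (intro represents_add represents_smult represents_companion_mat f mult w)
    moreover have "C *\<^sub>v w + - 1 \<cdot>\<^sub>v (E *\<^sub>v w) = e"
    proof -
      have "C *\<^sub>v w = E *\<^sub>v w + U *\<^sub>v w"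
        unfolding CEU by (rule add_mult_distrib_mat_vec[OF E U wc])
      moreover have "U *\<^sub>v w = e"
        unfolding w_def using assoc_mult_mat_vec[OF U V e(1)] UV e(1) by simp
      ultimately show ?thesis using E wc e(1)
        by (intro eq_vecI) (auto simp del: index_mult_mat_vec)
    qed
    ultimately have "represents f e (pCons 0 v + smult (- 1) (g * v))" by simp
    from represents_dvd_diff[OF this e(2)] show ?thesis by (simp add: algebra_simps)
  qed
  ultimately show ?thesis unfolding strongly_clean_root_def by blast
qed

section \<open>Maximal ideals and local rings\<close>

abbreviation type_ring :: "'a::comm_ring_1 itself \<Rightarrow> 'a ring" where
  "type_ring T \<equiv> ring_of_type_algebra"

lemma ideal_type_ring_iff:
  "ideal I (type_ring TYPE('a::comm_ring_1)) \<longleftrightarrow> comm_ideal I"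
proof
  assume "ideal I (type_ring TYPE('a))"
  then interpret I: ideal I "type_ring TYPE('a)" .
  show "comm_ideal I"
    using additive_subgroup.zero_closed[OF I.is_additive_subgroup] additive_subgroup.a_closed[OF I.is_additive_subgroup] I.I_l_closed
    by unfold_locales (auto simp: ring_of_type_algebra_def)
next
  assume "comm_ideal I"
  then interpret comm_ideal I .
  interpret R: cring "type_ring TYPE('a)" by (rule cring_from_type_algebra)
  show "ideal I (type_ring TYPE('a))"
  proof (rule idealI)
    show "ring (type_ring TYPE('a))" by (rule R.ring_axioms)
    show "subgroup I (add_monoid (type_ring TYPE('a)))"
    proof (rule R.add.subgroupI)
      fix x assume "x \<in> I"
      moreover have "\<ominus>\<^bsub>type_ring TYPE('a)\<^esub> x = - x"
        by (rule R.minus_equality) (auto simp: ring_of_type_algebra_def)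
      ultimately show "\<ominus>\<^bsub>type_ring TYPE('a)\<^esub> x \<in> I"
        using diff_mem[OF zero_mem] by simp
    qed (use zero_mem add_mem in \<open>auto simp: ring_of_type_algebra_def\<close>)
  qed (use mult_mem in \<open>auto simp: ring_of_type_algebra_def mult.commute\<close>)
qed

lemma comm_ideal_eq_UNIV_iff: "comm_ideal I \<Longrightarrow> I = UNIV \<longleftrightarrow> 1 \<in> I"
  using comm_ideal.mult_mem[of I 1] by auto

lemma maximalideal_type_ring_iff:
  "maximalideal M (type_ring TYPE('a::comm_ring_1)) \<longleftrightarrow>
     comm_ideal M \<and> 1 \<notin> M \<and> (\<forall>J. comm_ideal J \<and> M \<subseteq> J \<longrightarrow> J = M \<or> J = UNIV)"
proof -
  have "carrier (type_ring TYPE('a)) = UNIV" by (simp add: ring_of_type_algebra_def)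
  then show ?thesis
    unfolding maximalideal_def maximalideal_axioms_def ideal_type_ring_iff
    using comm_ideal_eq_UNIV_iff[of M] by auto
qed

lemma nonunit_in_maximalideal:
  fixes x :: "'a::comm_ring_1"
  assumes "\<not> x dvd 1"
  shows "\<exists>M. maximalideal M (type_ring TYPE('a)) \<and> x \<in> M"
proof -
  define S where "S = {J. comm_ideal J \<and> 1 \<notin> J \<and> x \<in> J}"
  have "comm_ideal {y. x dvd y}" by unfold_locales auto
  then have "S \<noteq> {}" using assms by (auto simp: S_def)
  moreover have "\<Union>\<C> \<in> S" if C: "\<C> \<noteq> {}" "subset.chain S \<C>" for \<C>
  proof -
    have sub: "\<And>J. J \<in> \<C> \<Longrightarrow> comm_ideal J \<and> 1 \<notin> J \<and> x \<in> J"
      using C(2) by (auto simp: subset.chain_def S_def)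
    have "comm_ideal (\<Union>\<C>)"
    proof
      show "0 \<in> \<Union>\<C>" using C(1) sub comm_ideal.zero_mem by blast
      show "r * y \<in> \<Union>\<C>" if "y \<in> \<Union>\<C>" for r y
        using that sub comm_ideal.mult_mem by blast
      fix y z assume "y \<in> \<Union>\<C>" "z \<in> \<Union>\<C>"
      then obtain J K where "y \<in> J" "J \<in> \<C>" "z \<in> K" "K \<in> \<C>" by blast
      moreover then have "J \<subseteq> K \<or> K \<subseteq> J" using C(2) by (auto simp: subset_chain_def)
      ultimately show "y + z \<in> \<Union>\<C>" using sub comm_ideal.add_mem by blast
    qed
    then show ?thesis using C(1) sub by (auto simp: S_def)
  qed
  ultimately obtain M where M: "M \<in> S" "\<forall>J\<in>S. M \<subseteq> J \<longrightarrow> J = M"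
    using subset_Zorn_nonempty[of S] by auto
  have "maximalideal M (type_ring TYPE('a))"
    unfolding maximalideal_type_ring_iff
  proof (intro conjI allI impI)
    fix J assume J: "comm_ideal J \<and> M \<subseteq> J"
    show "J = M \<or> J = UNIV"
    proof (cases "1 \<in> J")
      case False
      then have "J \<in> S" using J M(1) by (auto simp: S_def)
      then show ?thesis using M(2) J by blast
    qed (use J comm_ideal_eq_UNIV_iff in blast)
  qed (use M(1) in \<open>auto simp: S_def\<close>)
  then show ?thesis using M(1) by (auto simp: S_def)
qed

text \<open>In a local ring the nonunits are exactly the elements of the maximal ideal, since every nonunit lies in some
  maximal ideal.\<close>
lemma local_ring_imp_local_ideal:
  assumes "local_ring (type_ring TYPE('a::comm_ring_1))"
  shows "\<exists>I :: 'a set. local_ideal I"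
proof -
  obtain M where M: "maximalideal M (type_ring TYPE('a))"
    and uniq: "\<And>N. maximalideal N (type_ring TYPE('a)) \<Longrightarrow> N = M"
    using assms unfolding local_ring_def by blast
  have "local_ideal M" unfolding local_ideal_def local_ideal_axioms_def
  proof (intro conjI allI impI)
    show "comm_ideal M" "1 \<notin> M" using M by (auto simp: maximalideal_type_ring_iff)
    fix x assume "x \<notin> M"
    then show "x dvd 1" using nonunit_in_maximalideal[of x] uniq by auto
  qed
  then show ?thesis by blast
qed

lemma distinct_maximal_comaximal:
  assumes M: "maximalideal M (type_ring TYPE('a::comm_ring_1))"
    and N: "maximalideal N (type_ring TYPE('a))" and "M \<noteq> N"
  shows "\<exists>a\<in>M. 1 - a \<in> N"
proof -
  interpret M: comm_ideal M using M by (simp add: maximalideal_type_ring_iff)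
  interpret N: comm_ideal N using N by (simp add: maximalideal_type_ring_iff)
  define J where "J = {a + b | a b. a \<in> M \<and> b \<in> N}"
  have J: "comm_ideal J"
  proof
    show "0 \<in> J" using M.zero_mem N.zero_mem unfolding J_def by force
    fix x assume "x \<in> J"
    then obtain a b where x: "x = a + b" "a \<in> M" "b \<in> N" by (auto simp: J_def)
    show "r * x \<in> J" for r
      using M.mult_mem[OF x(2)] N.mult_mem[OF x(3)] unfolding x(1) J_def by (auto simp: distrib_left)
    fix y assume "y \<in> J"
    then obtain c d where y: "y = c + d" "c \<in> M" "d \<in> N" by (auto simp: J_def)
    have "x + y = (a + c) + (b + d)" using x y by (simp add: algebra_simps)
    then show "x + y \<in> J"
      using M.add_mem[OF x(2) y(2)] N.add_mem[OF x(3) y(3)] unfolding J_def by blast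
  qed
  have "M \<subseteq> J" using N.zero_mem unfolding J_def by force
  moreover have "N \<subseteq> J" using M.zero_mem unfolding J_def by force
  ultimately have "J = UNIV"
    using M N J \<open>M \<noteq> N\<close> unfolding maximalideal_type_ring_iff by (metis UNIV_I)
  then obtain a b where ab: "1 = a + b" "a \<in> M" "b \<in> N" unfolding J_def by blast
  then have "1 - a = b" by (metis add_diff_cancel_left')
  with ab show ?thesis by blast
qed

section \<open>SRC rings are local\<close>

locale prime_comm_ideal = comm_ideal +
  assumes prime_one: "1 \<notin> I"
    and prime_mult: "x * y \<in> I \<Longrightarrow> x \<in> I \<or> y \<in> I"
begin

text \<open>The hypothesis says that modulo \<open>I\<close> the product is \<open>t\<^sup>n\<close>, \<open>n\<close> its degree. If the constant term of \<open>p\<close>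
  survives modulo \<open>I\<close>, then the lowest terms of \<open>q\<close> and \<open>p q\<close> modulo \<open>I\<close> have the same degree, which
  is therefore \<open>n\<close>; no degree is left for \<open>p\<close>.\<close>
lemma factor_of_power_eq_1:
  fixes p q :: "'a poly"
  assumes p: "lead_coeff p = 1" and q: "lead_coeff q = 1"
    and low: "\<And>i. i < degree p + degree q \<Longrightarrow> coeff (p * q) i \<in> I"
    and p0: "coeff p 0 \<notin> I"
  shows "p = 1"
proof -
  define k where "k = (LEAST k. coeff q k \<notin> I)"
  have ex: "coeff q (degree q) \<notin> I" using q prime_one by simp
  have k: "coeff q k \<notin> I" unfolding k_def by (rule LeastI, rule ex)
  have kq: "k \<le> degree q" unfolding k_def by (rule Least_le, rule ex)
  have below: "coeff q i \<in> I" if "i < k" for i using not_less_Least[OF that[unfolded k_def]] by simp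
  have "coeff (p * q) k = coeff p 0 * coeff q k + (\<Sum>i\<in>{..k} - {0}. coeff p i * coeff q (k - i))"
    unfolding coeff_mult by (subst sum.remove[of _ 0]) auto
  moreover have "(\<Sum>i\<in>{..k} - {0}. coeff p i * coeff q (k - i)) \<in> I"
    by (rule sum_mem, rule mult_mem, rule below) auto
  moreover have "coeff p 0 * coeff q k \<notin> I" using prime_mult p0 k by blast
  ultimately have "coeff (p * q) k \<notin> I"
    using diff_mem[of "coeff (p * q) k"] by fastforce
  then have "degree p = 0" using low[of k] kq by fastforce
  then show ?thesis using p by (elim degree_eq_zeroE) (simp add: one_pCons)
qed

end

lemma maximalideal_imp_prime:
  assumes "maximalideal M (type_ring TYPE('a::comm_ring_1))"
  shows "prime_comm_ideal M"
proof -
  interpret R: cring "type_ring TYPE('a)" by (rule cring_from_type_algebra)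
  have "primeideal M (type_ring TYPE('a))" using R.maximalideal_prime[OF assms] .
  then have "x * y \<in> M \<Longrightarrow> x \<in> M \<or> y \<in> M" for x y
    using primeideal.I_prime[of M "type_ring TYPE('a)" x y] by (simp add: ring_of_type_algebra_def)
  then show ?thesis using assms unfolding maximalideal_type_ring_iff
    by (simp add: prime_comm_ideal_def prime_comm_ideal_axioms_def)
qed

text \<open>Distinct maximal ideals \<open>M\<close>, \<open>N\<close> are excluded by \<open>f = t\<^sup>n - a t\<^sup>n\<^sup>-\<^sup>1\<close> with \<open>a \<in> M\<close>, \<open>1 - a \<in> N\<close>. Modulo \<open>M\<close> it is
  a power of \<open>t\<close>, so it splits only trivially; at an idempotent \<open>e\<close> its value is \<open>e (1 - a)\<close>, because
  \<open>n - 1 \<ge> 1\<close>.\<close>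
lemma SRC_ring_imp_local_ring:
  assumes n: "n \<ge> 2" and SRC: "SRC_ring TYPE('a::comm_ring_1) n"
  shows "local_ring (type_ring TYPE('a))"
proof -
  obtain M where M: "maximalideal M (type_ring TYPE('a))"
    using nonunit_in_maximalideal[of "0::'a"] by auto
  have "N = M" if N: "maximalideal N (type_ring TYPE('a))" for N
  proof (rule ccontr)
    assume "N \<noteq> M"
    then obtain a where a: "a \<in> M" "1 - a \<in> N" using distinct_maximal_comaximal[OF M N] by blast
    interpret prime_comm_ideal M using maximalideal_imp_prime[OF M] .
    define f where "f = Polynomial.monom 1 n - Polynomial.monom a (n - 1)"
    have f: "degree f = n \<and> lead_coeff f = 1"
      using n by (intro degree_lead_coeff_eqI) (auto simp: f_def)
    obtain f0 f1 where fac: "f = f0 * f1" "lead_coeff f0 = 1" "lead_coeff f1 = 1" and um: "unimodular f0 f1"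
      and ex: "\<exists>e0 e1. e0 * e0 = e0 \<and> e1 * e1 = e1 \<and> poly f0 e0 dvd 1 \<and> poly f1 e1 dvd 1"
      using SRC f unfolding SRC_ring_def SRC_factorization_def SR_factorization_def by blast
    have low: "coeff (f0 * f1) i \<in> M" if "i < n" for i
      using that a(1) zero_mem diff_mem[OF zero_mem a(1)] unfolding fac(1)[symmetric] f_def by auto
    have deg: "degree f0 + degree f1 = n" using degree_mult_monic[OF fac(2,3)] fac(1) f by simp
    obtain p q where pq: "f0 * p + f1 * q = 1"
      using um unfolding unimodular_def by (auto simp: set_eq_iff dest!: spec[of _ 1])
    (* By unimodularity t does not divide both factors modulo M. *)
    have "coeff p 0 * coeff f0 0 + coeff q 0 * coeff f1 0 = 1"
      using arg_cong[OF pq, of "\<lambda>p. coeff p 0"] by (simp add: coeff_mult_0 mult.commute)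
    then have "coeff f0 0 \<notin> M \<or> coeff f1 0 \<notin> M"
      using prime_one add_mem[OF mult_mem mult_mem] by metis
    then have "f0 = 1 \<or> f1 = 1"
      using factor_of_power_eq_1[OF fac(2,3)] factor_of_power_eq_1[OF fac(3,2)] low deg
      by (metis add.commute mult.commute)
    then obtain e where e: "e * e = e" "poly f e dvd 1" using ex fac(1) by auto
    have pow: "e ^ Suc k = e" for k by (induction k) (simp_all add: e(1))
    have "e ^ n = e" "e ^ (n - 1) = e"
      using pow[of "n - 1"] pow[of "n - 2"] n by (simp_all add: Suc_diff_Suc numeral_2_eq_2)
    then have "poly f e = e * (1 - a)" by (simp add: f_def poly_monom algebra_simps)
    then have "1 - a dvd 1" using e(2) by (metis dvd_mult_right)
    then obtain c where "1 = c * (1 - a)" by (metis dvdE mult.commute)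
    then show False
      using N comm_ideal.mult_mem[of N "1 - a" c] a(2) unfolding maximalideal_type_ring_iff by metis
  qed
  with M show ?thesis unfolding local_ring_def using cring_from_type_algebra by blast
qed

section \<open>Strongly clean matrix rings over local rings\<close>

text \<open>Companion matrices produce every monic polynomial of degree \<open>n\<close>, and characteristic polynomials are
  monic of degree \<open>n\<close>.\<close>
lemma strongly_clean_ring_mat_iff_SRC_ring:
  assumes loc: "local_ring (type_ring TYPE('a::comm_ring_1))" and n: "n > 0"
  shows "strongly_clean_ring (ring_mat TYPE('a) n b) \<longleftrightarrow> SRC_ring TYPE('a) n"
proof -
  obtain I :: "'a set" where "local_ideal I" using local_ring_imp_local_ideal[OF loc] by blast
  then interpret local_ideal I .
  show ?thesis
  proof
    assume clean: "strongly_clean_ring (ring_mat TYPE('a) n b)"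
    show "SRC_ring TYPE('a) n" unfolding SRC_ring_def
    proof (intro allI impI)
      fix f :: "'a poly" assume f: "lead_coeff f = 1 \<and> degree f = n"
      then have "strongly_clean (ring_mat TYPE('a) n b) (companion_mat f)"
        using clean companion_mat_carrier[of f] by (auto simp: strongly_clean_ring_def ring_mat_simps)
      then have "strongly_clean_root f"
        using f n strongly_clean_root_if_companion_mat[of f] by auto
      then show "\<exists>f0 f1. SRC_factorization f f0 f1"
        using f SRC_factorization_if_strongly_clean_root by blast
    qed
  next
    assume SRC: "SRC_ring TYPE('a) n"
    have "strongly_clean (ring_mat TYPE('a) n b) A" if A: "A \<in> carrier_mat n n" for A
    proof -
      have "degree (char_poly A) = n \<and> lead_coeff (char_poly A) = 1"
        using degree_monic_char_poly[OF A] by auto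
      then have "strongly_clean_root (char_poly A)"
        using SRC strongly_clean_root_if_SRC_factorization unfolding SRC_ring_def by blast
      then show ?thesis by (rule strongly_clean_if_strongly_clean_root[OF A])
    qed
    then show "strongly_clean_ring (ring_mat TYPE('a) n b)"
      unfolding strongly_clean_ring_def ring_mat_simps by (intro conjI ballI ring_mat)
  qed
qed

theorem theorem14:
  fixes n :: nat
  assumes "n \<ge> 2"
  shows "(SRC_ring TYPE('a::comm_ring_1) n \<longleftrightarrow>
            local_ring (ring_of_type_algebra :: 'a ring) \<and> SRC_ring TYPE('a) n)
       \<and> (local_ring (ring_of_type_algebra :: 'a ring) \<and> SRC_ring TYPE('a) n \<longleftrightarrow>
            local_ring (ring_of_type_algebra :: 'a ring) \<and>
            strongly_clean_ring (ring_mat TYPE('a) n ()))"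
  using assms SRC_ring_imp_local_ring[OF assms] strongly_clean_ring_mat_iff_SRC_ring[where 'a = 'a and n = n and b = "()"]
  by auto

end
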